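(* Let $m,n$ be nonnegative integers. The set $\mathcal{IC}([m]\times[n])$ of interval-closed sets of $[m]\times[n]$ is in bijection with the set $\widetilde{\mathcal{M}}^{2}_{m,n}$ of bicolored Motzkin paths $M$ in which no $\mathtt{h}_2$ step on the $x$-axis is immediately followed by an $\mathtt{h}_1$ step, and such that $u(M)+h_1(M)=m$ and $d(M)+h_2(M)=n$.
   Context: For a finite poset $P$, a subset $I\subseteq P$ is an interval-closed set if for all $a,b\in I$ and $z\in P$ with $a<z<b$ we have $z\in I$; $\mathcal{IC}(P)$ is the set of all interval-closed sets of $P$ (including the empty set). $[m]\times[n]=\{(i,j): 1\le i\le m,\ 1\le j\le n\}$ is ordered componentwise: $(a,b)\le(c,d)$ iff $a\le c$ and $b\le d$. A bicolored Motzkin path of length $\ell$ is a lattice path from $(0,0)$ to $(\ell,0)$ that never goes below the $x$-axis and consists of steps of four types: $\mathtt{u}=(1,1)$, $\mathtt{d}=(1,-1)$, and two kinds (colors) of horizontal steps $(1,0)$, denoted $\mathtt{h}_1$ and $\mathtt{h}_2$. For such a path $M$, the numbers $u(M),d(M),h_1(M),h_2(M)$ are the numbers of $\mathtt{u},\mathtt{d},\mathtt{h}_1,\mathtt{h}_2$ steps of $M$, respectively (so the paths in the claim have length $m+n$). *)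

theory Defs
  imports Main "HOL-Library.Product_Order"
begin

definition interval_closed_sets :: "'a::order set \<Rightarrow> 'a set set" where
  "interval_closed_sets P =
     {I. I \<subseteq> P \<and> (\<forall>a\<in>I. \<forall>b\<in>I. \<forall>z\<in>P. a < z \<and> z < b \<longrightarrow> z \<in> I)}"

text \<open>The order on \<open>nat \<times> nat\<close> is the componentwise one of \<^theory>\<open>HOL-Library.Product_Order\<close>.\<close>

definition grid :: "nat \<Rightarrow> nat \<Rightarrow> (nat \<times> nat) set" where
  "grid m n = {1..m} \<times> {1..n}"

datatype step = U | D | H1 | H2

fun rise :: "step \<Rightarrow> int" where
  "rise U = 1"
| "rise D = - 1"
| "rise H1 = 0"
| "rise H2 = 0"

text \<open>
  Every step advances the abscissa by 1, so a path starting at the origin is given by its list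
  of steps: after the first \<open>i\<close> steps it is at the point \<open>(i, height w i)\<close>.
\<close>

definition height :: "step list \<Rightarrow> nat \<Rightarrow> int" where
  "height w i = (\<Sum>s\<leftarrow>take i w. rise s)"

definition bicolored_motzkin_path :: "step list \<Rightarrow> bool" where
  "bicolored_motzkin_path w \<longleftrightarrow>
     height w (length w) = 0 \<and> (\<forall>i\<le>length w. 0 \<le> height w i)"

definition no_h2h1_on_axis :: "step list \<Rightarrow> bool" where
  "no_h2h1_on_axis w \<longleftrightarrow>
     \<not> (\<exists>i. Suc i < length w \<and> height w i = 0 \<and> w ! i = H2 \<and> w ! Suc i = H1)"

definition motzkin_paths :: "nat \<Rightarrow> nat \<Rightarrow> step list set" where
  "motzkin_paths m n =
     {w. bicolored_motzkin_path w \<and> no_h2h1_on_axis w \<and>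
         count_list w U + count_list w H1 = m \<and>
         count_list w D + count_list w H2 = n}"

end

theory Submission
  imports Defs
begin

text \<open>
  An interval-closed set is a difference \<open>V - L\<close> of two down-closed sets \<open>L \<subseteq> V\<close> of the grid.
  A down-closed set is the part of the grid under a lattice path with east and south unit steps
  from the upper left corner \<open>(0, n)\<close> to the lower right corner \<open>(m, 0)\<close>, so that \<open>(L, V)\<close> becomes
  a pair of such paths, one weakly above the other.  Reading the two paths simultaneously turns the
  pair into a word: \<open>U\<close> means that the upper path goes east and the lower one south, \<open>D\<close> is the
  reverse, \<open>H1\<close> means that both go east and \<open>H2\<close> that both go south.  The height of the word is the
  number of cells between the two paths on the current diagonal; hence nested pairs of paths
  are exactly bicolored Motzkin paths, and the upper path has \<open>u + h\<^sub>1 = m\<close> east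
  and \<open>d + h\<^sub>2 = n\<close> south steps.

  The pair \<open>(L, V)\<close> is not determined by \<open>V - L\<close>: where the two paths run together, they can be moved
  together.  The choice is made canonical by taking \<open>L\<close> as large as possible, that is, as the set of
  all cells that are not equal to or above an element of \<open>V - L\<close>.  The largest \<open>L\<close> is
  characterized locally: no cell outside \<open>V\<close> can be added to \<open>L\<close>, and such a cell is precisely a common corner of
  the two paths with a south step followed by an east step, i.e. a factor \<open>H2, H1\<close> on the axis.
  The lemmas \<open>flush_pair_of_ics\<close> (existence of the canonical pair) and
  \<open>below_eq_not_above_difference\<close> (its uniqueness) carry this argument.
\<close>

section \<open>Down-closed subsets of the grid as lattice paths\<close>

text \<open>
  A path from \<open>(0, n)\<close> to \<open>(m, 0)\<close> with unit east and south steps is encoded by the function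
  giving the abscissa after \<open>i\<close> steps; the ordinate is then \<open>n + a i - i\<close>.
\<close>

definition profile :: "nat \<Rightarrow> nat \<Rightarrow> (nat \<Rightarrow> nat) \<Rightarrow> bool" where
  "profile m n a \<longleftrightarrow> a 0 = 0 \<and> a (m + n) = m \<and>
     (\<forall>i<m + n. a (Suc i) = a i \<or> a (Suc i) = Suc (a i))"

text \<open>
  The cell \<open>(x, y)\<close> is the unit square with upper right corner \<open>(x, y)\<close>.  The path crosses the
  diagonal through that corner after exactly \<open>n + x - y\<close> steps, so the cell lies under the path
  iff the crossing point is not to the left of the corner.
\<close>

definition below :: "nat \<Rightarrow> nat \<Rightarrow> (nat \<Rightarrow> nat) \<Rightarrow> (nat \<times> nat) set" where
  "below m n a = {(x, y) \<in> grid m n. x \<le> a (n + x - y)}"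

definition down_closed_in :: "'a::order set \<Rightarrow> 'a set \<Rightarrow> bool" where
  "down_closed_in P J \<longleftrightarrow> J \<subseteq> P \<and> (\<forall>z\<in>J. \<forall>y\<in>P. y \<le> z \<longrightarrow> y \<in> J)"

lemma in_grid [simp]: "(x, y) \<in> grid m n \<longleftrightarrow> 1 \<le> x \<and> x \<le> m \<and> 1 \<le> y \<and> y \<le> n"
  by (auto simp: grid_def)

lemma in_below:
  "(x, y) \<in> below m n a \<longleftrightarrow> 1 \<le> x \<and> x \<le> m \<and> 1 \<le> y \<and> y \<le> n \<and> x \<le> a (n + x - y)"
  by (auto simp: below_def)

lemma profile_step:
  assumes "profile m n a" "i < m + n"
  shows "a (Suc i) = a i \<or> a (Suc i) = Suc (a i)"
  using assms by (simp add: profile_def)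

lemma profile_increment:
  assumes "profile m n a" "i + k \<le> m + n"
  shows "a i \<le> a (i + k) \<and> a (i + k) \<le> a i + k"
  using assms(2)
proof (induction k)
  case (Suc k)
  then show ?case using profile_step[OF assms(1), of "i + k"] by auto
qed simp

lemma profile_mono:
  assumes "profile m n a" "i \<le> j" "j \<le> m + n"
  shows "a i \<le> a j" "a j \<le> a i + (j - i)"
  using profile_increment[OF assms(1), of i "j - i"] assms(2,3) by auto

lemma profile_bounds:
  assumes "profile m n a" "i \<le> m + n"
  shows "a i \<le> i" "a i \<le> m" "i \<le> n + a i"
  using profile_mono[OF assms(1), of 0 i] profile_mono[OF assms(1), of i "m + n"] assms
  by (auto simp: profile_def)

lemma below_down_closed:
  assumes a: "profile m n a"
  shows "down_closed_in (grid m n) (below m n a)"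
  unfolding down_closed_in_def
proof (intro conjI ballI impI)
  show "below m n a \<subseteq> grid m n" by (auto simp: below_def)
  fix z w assume z: "z \<in> below m n a" and w: "w \<in> grid m n" and le: "w \<le> z"
  obtain x y x' y' where eq: "z = (x, y)" "w = (x', y')" by (metis surj_pair)
  have x: "1 \<le> x" "x \<le> m" "1 \<le> y" "y \<le> n" "x \<le> a (n + x - y)"
    and x': "1 \<le> x'" "x' \<le> m" "1 \<le> y'" "y' \<le> n" and "x' \<le> x" "y' \<le> y"
    using z w le by (auto simp: eq in_below)
  have "a (n + x - y) \<le> a (n + x' - y) + (x - x')"
    using profile_mono(2)[OF a, of "n + x' - y" "n + x - y"] x x' \<open>x' \<le> x\<close> by auto
  moreover have "a (n + x' - y) \<le> a (n + x' - y')"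
    using profile_mono(1)[OF a, of "n + x' - y" "n + x' - y'"] x x' \<open>y' \<le> y\<close> by auto
  ultimately show "w \<in> below m n a"
    using x x' \<open>x' \<le> x\<close> by (auto simp: eq in_below)
qed

text \<open>
  Recovers a path from the cells under it.  The first two disjuncts deal with the points
  \<open>(x, n + x - i)\<close> of the \<open>i\<close>-th diagonal that are not upper right corners of cells, being on the
  vertical axis or not above the horizontal one; no path runs to the left of them.
\<close>

lemma le_profile_iff:
  assumes a: "profile m n a" and i: "i \<le> m + n"
  shows "x \<le> a i \<longleftrightarrow> x = 0 \<or> n + x \<le> i \<or> (x, n + x - i) \<in> below m n a"
proof (cases "x = 0 \<or> n + x \<le> i")
  case True
  then show ?thesis using profile_bounds[OF a i] by auto
next
  case False
  then have "n + x - (n + x - i) = i" by simp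
  then show ?thesis using False profile_bounds[OF a i] by (auto simp: in_below)
qed

lemma profile_eq_of_below_eq:
  assumes "profile m n a" "profile m n b" "below m n a = below m n b" "i \<le> m + n"
  shows "a i = b i"
proof -
  have "x \<le> a i \<longleftrightarrow> x \<le> b i" for x
    using le_profile_iff[OF assms(1,4)] le_profile_iff[OF assms(2,4)] assms(3) by simp
  then show ?thesis by (meson order_antisym order_refl)
qed

lemma profile_le_of_below_subset:
  assumes "profile m n a" "profile m n b" "below m n a \<subseteq> below m n b" "i \<le> m + n"
  shows "a i \<le> b i"
  using le_profile_iff[OF assms(1,4), of "a i"] le_profile_iff[OF assms(2,4), of "a i"] assms(3)
  by auto

lemma below_mono:
  assumes "\<And>i. i \<le> m + n \<Longrightarrow> a i \<le> b i"
  shows "below m n a \<subseteq> below m n b"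
proof
  fix z assume "z \<in> below m n a"
  moreover obtain x y where "z = (x, y)" by fastforce
  ultimately show "z \<in> below m n b"
    using assms[of "n + x - y"] by (fastforce simp: in_below)
qed

text \<open>
  The criterion of \<open>le_profile_iff\<close> is turned into a definition: the path crosses the
  \<open>i\<close>-th diagonal at the greatest \<open>x\<close> that satisfies it.
\<close>

lemma down_closed_eq_below:
  assumes J: "down_closed_in (grid m n) J"
  shows "\<exists>a. profile m n a \<and> below m n a = J"
proof -
  define under where "under i x \<longleftrightarrow> x = 0 \<or> n + x \<le> i \<or> (x, n + x - i) \<in> J" for i x
  define a where "a i = (GREATEST x. under i x)" for i
  have sub: "J \<subseteq> grid m n" and down: "\<And>z w. z \<in> J \<Longrightarrow> w \<in> grid m n \<Longrightarrow> w \<le> z \<Longrightarrow> w \<in> J"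
    using J by (auto simp: down_closed_in_def)
  have bounds: "x \<le> m" if "under i x" "i \<le> m + n" for i x
    using that sub by (auto simp: under_def)
  have pred: "under i x" if "under i (Suc x)" for i x
    using that sub down[of "(Suc x, n + Suc x - i)" "(x, n + x - i)"]
    by (fastforce simp: under_def)
  have right: "under (Suc i) x" if "under i x" for i x
    using that sub down[of "(x, n + x - i)" "(x, n + x - Suc i)"]
    by (fastforce simp: under_def)
  have left: "under i x" if "under (Suc i) (Suc x)" for i x
    using that sub down[of "(Suc x, n + x - i)" "(x, n + x - i)"]
    by (fastforce simp: under_def)
  have "under i 0" for i by (simp add: under_def)
  then have max: "under i (a i)" "under i x \<Longrightarrow> x \<le> a i" if "i \<le> m + n" for i x
    using bounds[OF _ that] GreatestI_nat[of "under i"] Greatest_le_nat[of "under i"]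
    unfolding a_def by blast+
  have under_le: "under i x" if "under i y" "x \<le> y" for i x y
    using that(2,1) by (induction rule: inc_induct) (auto intro: pred)
  have iff: "under i x \<longleftrightarrow> x \<le> a i" if "i \<le> m + n" for i x
    using max[OF that] under_le by blast
  have "a (Suc i) = a i \<or> a (Suc i) = Suc (a i)" if "i < m + n" for i
  proof -
    have "a i \<le> a (Suc i)" using iff[of "Suc i"] iff[of i] right that by auto
    moreover have "a (Suc i) \<le> Suc (a i)"
      using iff[of "Suc i" "a (Suc i)"] iff[of i "a (Suc i) - 1"] left[of i "a (Suc i) - 1"] that
      by (cases "a (Suc i)") auto
    ultimately show ?thesis by auto
  qed
  moreover have "a 0 = 0"
  proof -
    have "\<not> under 0 (Suc 0)" using sub by (auto simp: under_def)
    then show ?thesis using iff[of 0 "Suc 0"] by simp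
  qed
  moreover have "a (m + n) = m"
    using bounds[OF max(1)] iff[of "m + n" m] by (auto simp: under_def intro: antisym)
  ultimately have "profile m n a" by (simp add: profile_def)
  moreover have "below m n a = J"
  proof -
    have "(x, y) \<in> below m n a \<longleftrightarrow> (x, y) \<in> J" for x y
    proof (cases "(x, y) \<in> grid m n")
      case True
      then have "n + x - (n + x - y) = y" "\<not> n + x \<le> n + x - y" "n + x - y \<le> m + n" by auto
      then show ?thesis
        using True iff[of "n + x - y" x] by (auto simp: in_below under_def)
    qed (use sub in \<open>auto simp: in_below\<close>)
    then show ?thesis by auto
  qed
  ultimately show ?thesis by blast
qed

section \<open>Interval-closed sets as canonical pairs of paths\<close>

text \<open>
  The last condition forbids a common corner of the two paths at which both turn from south to
  east: the cell with this lower left corner is outside both regions and could be added to both.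
\<close>

definition flush_pair :: "nat \<Rightarrow> nat \<Rightarrow> (nat \<Rightarrow> nat) \<Rightarrow> (nat \<Rightarrow> nat) \<Rightarrow> bool" where
  "flush_pair m n p q \<longleftrightarrow> profile m n p \<and> profile m n q \<and> (\<forall>i\<le>m + n. p i \<le> q i) \<and>
     \<not> (\<exists>i. Suc (Suc i) \<le> m + n \<and> p i = q i \<and> p (Suc i) = p i \<and> q (Suc i) = q i \<and>
          p (Suc (Suc i)) = Suc (p i) \<and> q (Suc (Suc i)) = Suc (q i))"

lemma difference_interval_closed:
  assumes "down_closed_in P V" "down_closed_in P L"
  shows "V - L \<in> interval_closed_sets P"
  using assms unfolding interval_closed_sets_def down_closed_in_def
  by (auto dest: less_imp_le)

text \<open>
  The lower region is the largest one compatible with \<open>I\<close>.  At a forbidden common corner, the cell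
  beyond it is not in the upper region; being outside the lower region it is strictly above an
  element of \<open>I\<close>, which is then below the left or the lower neighbour of the cell.  But these
  neighbours are in the lower region.
\<close>

lemma flush_pair_of_ics:
  assumes I: "I \<in> interval_closed_sets (grid m n)"
  shows "\<exists>p q. flush_pair m n p q \<and> below m n q - below m n p = I"
proof -
  define L where "L = {z \<in> grid m n. \<not> (\<exists>c\<in>I. c \<le> z)}"
  have sub: "I \<subseteq> grid m n"
    and conv: "\<And>c b z. c \<in> I \<Longrightarrow> b \<in> I \<Longrightarrow> z \<in> grid m n \<Longrightarrow> c < z \<Longrightarrow> z < b \<Longrightarrow> z \<in> I"
    using I unfolding interval_closed_sets_def by blast+
  have "down_closed_in (grid m n) L"
    unfolding L_def down_closed_in_def by (blast intro: order_trans)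
  then obtain p where p: "profile m n p" and bp: "below m n p = L"
    using down_closed_eq_below by blast
  have "down_closed_in (grid m n) (L \<union> I)"
    unfolding down_closed_in_def
  proof (intro conjI ballI impI)
    show "L \<union> I \<subseteq> grid m n" using sub by (auto simp: L_def)
    fix z y assume z: "z \<in> L \<union> I" and y: "y \<in> grid m n" "y \<le> z"
    show "y \<in> L \<union> I"
    proof (cases "y \<in> L")
      case False
      then obtain c where c: "c \<in> I" "c \<le> y" using y by (auto simp: L_def)
      then have "z \<in> I" using z y(2) by (auto simp: L_def dest: order_trans)
      then show ?thesis using conv[of c z y] c y by (auto simp: order.order_iff_strict)
    qed simp
  qed
  then obtain q where q: "profile m n q" and bq: "below m n q = L \<union> I"
    using down_closed_eq_below by blast
  have le: "\<forall>i\<le>m + n. p i \<le> q i"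
    using profile_le_of_below_subset[OF p q] bp bq by blast
  have "False" if i: "Suc (Suc i) \<le> m + n" and e: "p i = q i" "p (Suc i) = p i" "q (Suc i) = q i"
      "p (Suc (Suc i)) = Suc (p i)" "q (Suc (Suc i)) = Suc (q i)" for i
  proof -
    define x where "x = p i"
    define y where "y = n + x - i"
    \<comment> \<open>The two paths meet in \<open>(x, y - 1)\<close> after \<open>i + 1\<close> steps.\<close>
    have "x \<le> i" "Suc i \<le> n + x" "Suc x \<le> m"
      using profile_bounds[OF p, of i] profile_bounds[OF p, of "Suc i"]
        profile_bounds[OF p, of "Suc (Suc i)"] i e by (auto simp: x_def)
    then have y: "1 \<le> y" "y \<le> n" "Suc (n + x) - y = Suc i" "n + x - y = i"
      by (auto simp: y_def)
    have x: "p i = x" "q (Suc i) = x" "p (Suc (Suc i)) = Suc x"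
      using e by (simp_all add: x_def)
    have "(Suc x, y) \<notin> below m n q"
      using x by (simp add: in_below y)
    then have cell: "(Suc x, y) \<in> grid m n" "(Suc x, y) \<notin> L" "(Suc x, y) \<notin> I"
      using y \<open>Suc x \<le> m\<close> bq by auto
    then obtain c where c: "c \<in> I" "c \<le> (Suc x, y)"
      unfolding L_def by blast
    obtain c1 c2 where c12: "c = (c1, c2)" by fastforce
    have c_grid: "1 \<le> c1" "1 \<le> c2" using c sub c12 by auto
    have "c1 \<le> x \<and> c2 \<le> y \<or> c1 \<le> Suc x \<and> c2 \<le> y - 1"
      using c cell(3) by (cases "c = (Suc x, y)") (auto simp: c12)
    then show False
    proof
      assume h: "c1 \<le> x \<and> c2 \<le> y"
      then have "(x, y) \<in> below m n p"
        using y x \<open>Suc x \<le> m\<close> c_grid h by (simp add: in_below)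
      then show False using bp c(1) h by (auto simp: L_def c12)
    next
      assume h: "c1 \<le> Suc x \<and> c2 \<le> y - 1"
      then have "Suc (n + x) - (y - 1) = Suc (Suc i)" using y c_grid by simp
      then have "(Suc x, y - 1) \<in> below m n p"
        using y x \<open>Suc x \<le> m\<close> c_grid h by (simp add: in_below)
      then show False using bp c(1) h by (auto simp: L_def c12)
    qed
  qed
  then have "flush_pair m n p q"
    unfolding flush_pair_def using p q le by blast
  moreover have "below m n q - below m n p = I"
    using bp bq by (auto simp: L_def)
  ultimately show ?thesis by blast
qed

text \<open>
  If some cell outside the lower region were not above any cell between the paths, a minimal
  cell below it outside the lower region would be outside the upper region as well, and its lower
  left corner would be a forbidden common corner of the two paths.
\<close>

lemma below_eq_not_above_difference:
  assumes pq: "flush_pair m n p q"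
  shows "below m n p = {z \<in> grid m n. \<not> (\<exists>c \<in> below m n q - below m n p. c \<le> z)}"
proof -
  have p: "profile m n p" and q: "profile m n q" and le: "\<And>i. i \<le> m + n \<Longrightarrow> p i \<le> q i"
    and corner: "\<And>i. Suc (Suc i) \<le> m + n \<Longrightarrow> p i = q i \<Longrightarrow> p (Suc i) = p i \<Longrightarrow> q (Suc i) = q i
      \<Longrightarrow> p (Suc (Suc i)) = Suc (p i) \<Longrightarrow> q (Suc (Suc i)) = Suc (q i) \<Longrightarrow> False"
    using pq by (auto simp: flush_pair_def)
  have down: "down_closed_in (grid m n) (below m n p)" using below_down_closed[OF p] .
  have "\<exists>c \<in> below m n q - below m n p. c \<le> z"
    if "z \<in> grid m n - below m n p" for z
    using that
  proof (induction "fst z + snd z" arbitrary: z rule: less_induct)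
    case less
    obtain x y where z: "z = (x, y)" by fastforce
    show ?case
    proof (rule ccontr)
      assume none: "\<not> ?thesis"
      have g: "1 \<le> x" "x \<le> m" "1 \<le> y" "y \<le> n" using less.prems by (auto simp: z)
      define i where "i = n + x - y - 1"
      have i: "n + x - y = Suc i" "Suc i \<le> m + n" using g by (auto simp: i_def)
      have "z \<notin> below m n q" using less.prems none by blast
      then have out: "q (Suc i) < x" using g by (simp add: z in_below i)
      have west: "(x - 1, y) \<in> below m n p" if gt: "x > 1"
      proof (rule ccontr)
        assume "(x - 1, y) \<notin> below m n p"
        then have "(x - 1, y) \<in> grid m n - below m n p" "fst (x - 1, y) + snd (x - 1, y) < fst z + snd z"
          using gt g by (auto simp: z)
        then obtain c where "c \<in> below m n q - below m n p" "c \<le> (x - 1, y)"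
          using less.hyps by blast
        then show False using none by (force simp: z less_eq_prod_def)
      qed
      have south: "(x, y - 1) \<in> below m n p" if gt: "y > 1"
      proof (rule ccontr)
        assume "(x, y - 1) \<notin> below m n p"
        then have "(x, y - 1) \<in> grid m n - below m n p" "fst (x, y - 1) + snd (x, y - 1) < fst z + snd z"
          using gt g by (auto simp: z)
        then obtain c where "c \<in> below m n q - below m n p" "c \<le> (x, y - 1)"
          using less.hyps by blast
        then show False using none by (force simp: z less_eq_prod_def)
      qed
      have "x - 1 \<le> p i"
        using west g by (cases "x > 1") (auto simp: in_below i_def)
      moreover have si: "Suc (Suc i) \<le> m + n"
      proof (rule ccontr)
        assume "\<not> Suc (Suc i) \<le> m + n"
        then have "Suc i = m + n" using i(2) by simp
        then show False using out g q by (auto simp: profile_def)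
      qed
      moreover have "x \<le> p (Suc (Suc i))"
      proof (cases "y > 1")
        case True
        have "n + x - (y - 1) = Suc (Suc i)" using True g by (simp add: i_def)
        then show ?thesis using south[OF True] by (simp add: in_below)
      next
        case False
        \<comment> \<open>A cell of the bottom row has no lower neighbour; here the bound holds because the
          ordinate of the path after \<open>n + x\<close> steps is nonnegative.\<close>
        then have "Suc (Suc i) = n + x" using g by (simp add: i_def)
        then show ?thesis using profile_bounds(3)[OF p si] by simp
      qed
      moreover have "p (Suc i) \<le> q (Suc i)" "p i \<le> q i" "p (Suc (Suc i)) \<le> q (Suc (Suc i))"
        using le si by simp_all
      ultimately show False
        using out profile_step[OF p, of i] profile_step[OF p, of "Suc i"]
          profile_step[OF q, of i] profile_step[OF q, of "Suc i"] corner[OF si]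
        by auto
    qed
  qed
  moreover have "\<not> c \<le> z"
    if "z \<in> below m n p" "c \<in> below m n q - below m n p" for z c
  proof -
    have "c \<in> grid m n" using that(2) by (auto simp: below_def)
    then show ?thesis using that down unfolding down_closed_in_def by blast
  qed
  moreover have "below m n p \<subseteq> grid m n" using down by (simp add: down_closed_in_def)
  ultimately show ?thesis by blast
qed

lemma flush_pair_unique:
  assumes "flush_pair m n p q" "flush_pair m n p' q'"
    and eq: "below m n q - below m n p = below m n q' - below m n p'" and i: "i \<le> m + n"
  shows "p i = p' i" "q i = q' i"
proof -
  have prof: "profile m n p" "profile m n q" "profile m n p'" "profile m n q'"
    using assms(1,2) by (auto simp: flush_pair_def)
  have L: "below m n p = below m n p'"
    using below_eq_not_above_difference[OF assms(1)] below_eq_not_above_difference[OF assms(2)]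
      eq by simp
  have "below m n p \<subseteq> below m n q" "below m n p' \<subseteq> below m n q'"
    using assms(1,2) by (auto simp: flush_pair_def intro!: below_mono)
  then have "below m n q = below m n q'" using L eq by blast
  then show "p i = p' i" "q i = q' i"
    using L prof i by (auto intro: profile_eq_of_below_eq)
qed

section \<open>Motzkin paths as canonical pairs of paths\<close>

definition count_in :: "step set \<Rightarrow> step list \<Rightarrow> nat \<Rightarrow> nat" where
  "count_in S w i = length (filter (\<lambda>s. s \<in> S) (take i w))"

abbreviation upper :: "step list \<Rightarrow> nat \<Rightarrow> nat" where
  "upper \<equiv> count_in {U, H1}"

abbreviation lower :: "step list \<Rightarrow> nat \<Rightarrow> nat" where
  "lower \<equiv> count_in {D, H1}"

lemma count_in_0 [simp]: "count_in S w 0 = 0"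
  by (simp add: count_in_def)

lemma count_in_Suc:
  "i < length w \<Longrightarrow> count_in S w (Suc i) = count_in S w i + (if w ! i \<in> S then 1 else 0)"
  by (simp add: count_in_def take_Suc_conv_app_nth)

lemma height_eq: "height w i = int (upper w i) - int (lower w i)"
proof -
  have "(\<Sum>s\<leftarrow>v. rise s) = int (length (filter (\<lambda>s. s \<in> {U, H1}) v))
      - int (length (filter (\<lambda>s. s \<in> {D, H1}) v))" for v
  proof (induction v)
    case (Cons s v)
    then show ?case by (cases s) auto
  qed simp
  then show ?thesis by (simp add: height_def count_in_def)
qed

lemma upper_total: "upper w (length w) = count_list w U + count_list w H1"
proof -
  have "length (filter (\<lambda>s. s \<in> {U, H1}) w) = count_list w U + count_list w H1"
    by (induction w) auto
  then show ?thesis by (simp add: count_in_def)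
qed

lemma length_eq_counts:
  "length w = (count_list w U + count_list w H1) + (count_list w D + count_list w H2)"
proof (induction w)
  case (Cons s w)
  then show ?case by (cases s) auto
qed simp

lemma steps_iff:
  assumes "i < length w"
  shows "w ! i = H2 \<longleftrightarrow> lower w (Suc i) = lower w i \<and> upper w (Suc i) = upper w i"
    and "w ! i = H1 \<longleftrightarrow> lower w (Suc i) = Suc (lower w i) \<and> upper w (Suc i) = Suc (upper w i)"
  using count_in_Suc[OF assms] by (cases "w ! i"; simp)+

text \<open>
  The counts fix the length of the word and the end point of the upper path; the lower path ends at
  the same point because the height returns to 0.
\<close>

lemma motzkin_paths_iff:
  "w \<in> motzkin_paths m n \<longleftrightarrow> length w = m + n \<and> flush_pair m n (lower w) (upper w)"
proof (cases "length w = m + n")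
  case False
  then show ?thesis using length_eq_counts[of w] by (auto simp: motzkin_paths_def)
next
  case len: True
  have "bicolored_motzkin_path w \<longleftrightarrow>
      upper w (m + n) = lower w (m + n) \<and> (\<forall>i\<le>m + n. lower w i \<le> upper w i)"
    by (auto simp: bicolored_motzkin_path_def height_eq len)
  moreover have "no_h2h1_on_axis w \<longleftrightarrow>
     \<not> (\<exists>i. Suc (Suc i) \<le> m + n \<and> lower w i = upper w i \<and>
          lower w (Suc i) = lower w i \<and> upper w (Suc i) = upper w i \<and>
          lower w (Suc (Suc i)) = Suc (lower w i) \<and> upper w (Suc (Suc i)) = Suc (upper w i))"
    unfolding no_h2h1_on_axis_def
    using steps_iff[of _ w] len
    by (intro arg_cong[of _ _ Not] ex_cong1) (auto simp: height_eq)
  moreover have "profile m n (count_in S w) \<longleftrightarrow> count_in S w (m + n) = m" for S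
    using count_in_Suc[of _ w S] len by (auto simp: profile_def)
  moreover have "count_list w U + count_list w H1 = m \<and> count_list w D + count_list w H2 = n
      \<longleftrightarrow> upper w (m + n) = m"
    using upper_total[of w] length_eq_counts[of w] len by auto
  ultimately show ?thesis
    using len by (auto simp: motzkin_paths_def flush_pair_def)
qed

lemma word_eqI:
  assumes "length v = length w"
    and "\<And>i. i \<le> length w \<Longrightarrow> lower v i = lower w i"
    and "\<And>i. i \<le> length w \<Longrightarrow> upper v i = upper w i"
  shows "v = w"
proof (rule nth_equalityI)
  fix i assume i: "i < length v"
  have determined: "v ! i \<in> S \<longleftrightarrow> w ! i \<in> S"
    if "\<And>i. i \<le> length w \<Longrightarrow> count_in S v i = count_in S w i" for S
    using count_in_Suc[of i v S] count_in_Suc[of i w S] that[of i] that[of "Suc i"] i assms(1)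
    by (simp split: if_splits)
  have "v ! i \<in> {D, H1} \<longleftrightarrow> w ! i \<in> {D, H1}" "v ! i \<in> {U, H1} \<longleftrightarrow> w ! i \<in> {U, H1}"
    using assms(2,3) by (intro determined; blast)+
  then show "v ! i = w ! i" by (cases "v ! i"; cases "w ! i"; simp)
qed (fact assms(1))

lemma word_of_profiles:
  assumes p: "profile m n p" and q: "profile m n q"
  shows "\<exists>w. length w = m + n \<and> (\<forall>i\<le>m + n. lower w i = p i \<and> upper w i = q i)"
proof -
  define st where "st i = (if p (Suc i) = p i then if q (Suc i) = q i then H2 else U
    else if q (Suc i) = q i then D else H1)" for i
  define w where "w = map st [0..<m + n]"
  have "lower w i = p i \<and> upper w i = q i" if "i \<le> m + n" for i
    using that
  proof (induction i)
    case 0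
    then show ?case using p q by (simp add: profile_def)
  next
    case (Suc i)
    then show ?case
      using profile_step[OF p, of i] profile_step[OF q, of i]
      by (auto simp: count_in_Suc w_def st_def)
  qed
  then show ?thesis by (intro exI[of _ w]) (simp add: w_def)
qed

lemma flush_pair_cong:
  assumes "\<And>i. i \<le> m + n \<Longrightarrow> p i = p' i \<and> q i = q' i"
  shows "flush_pair m n p q \<longleftrightarrow> flush_pair m n p' q'"
  using assms unfolding flush_pair_def profile_def
  by (simp add: Suc_le_eq less_imp_le cong: conj_cong)

lemma below_cong:
  assumes "\<And>i. i \<le> m + n \<Longrightarrow> a i = b i"
  shows "below m n a = below m n b"
  using assms by (intro antisym below_mono) simp_all

theorem theorem3p3:
  fixes m n :: nat
  shows "\<exists>f. bij_betw f (interval_closed_sets (grid m n)) (motzkin_paths m n)"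
proof -
  define between where "between w = below m n (upper w) - below m n (lower w)" for w
  have "bij_betw between (motzkin_paths m n) (interval_closed_sets (grid m n))"
    unfolding bij_betw_def
  proof (intro conjI subset_antisym subsetI)
    show "inj_on between (motzkin_paths m n)"
    proof (rule inj_onI)
      fix v w assume "v \<in> motzkin_paths m n" "w \<in> motzkin_paths m n" "between v = between w"
      then show "v = w"
        using flush_pair_unique[of m n "lower v" "upper v" "lower w" "upper w"]
        by (intro word_eqI) (simp_all add: motzkin_paths_iff between_def)
    qed
  next
    fix I assume "I \<in> between ` motzkin_paths m n"
    then show "I \<in> interval_closed_sets (grid m n)"
      by (auto simp: between_def motzkin_paths_iff flush_pair_def
          intro!: difference_interval_closed below_down_closed)
  next
    fix I assume "I \<in> interval_closed_sets (grid m n)"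
    then obtain p q where pq: "flush_pair m n p q" and I: "below m n q - below m n p = I"
      using flush_pair_of_ics by blast
    then obtain w where w: "length w = m + n" "\<And>i. i \<le> m + n \<Longrightarrow> lower w i = p i \<and> upper w i = q i"
      using word_of_profiles[of m n p q] by (auto simp: flush_pair_def)
    then have "w \<in> motzkin_paths m n"
      using pq flush_pair_cong[of m n "lower w" p "upper w" q] by (simp add: motzkin_paths_iff)
    moreover have "between w = I"
      using w(2) below_cong[of m n "lower w" p] below_cong[of m n "upper w" q] I
      by (simp add: between_def)
    ultimately show "I \<in> between ` motzkin_paths m n" by blast
  qed
  then show ?thesis using bij_betw_inv by blast
qed

end
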